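(* If $G$ is a $2$-connected outerplanar graph with $n$ vertices, then $G$ contains an induced path of size $\frac{\log n}{2}$.
   Context: An outerplanar graph is a graph that can be drawn in the plane without crossing edges and with all vertices on the outer face. The size of a path is its number of vertices. Logarithms are base 2. *)

theory Defs
  imports "HOL-Analysis.Analysis" "Graph_Theory.Graph_Theory"
begin

text \<open>
  A finite simple graph is a symmetric loop-free digraph without parallel arcs (locale
  \<^locale>\<open>graph\<close>); an undirected edge \<open>{u, v}\<close> is the pair of opposite arcs between \<open>u\<close> and \<open>v\<close>.
\<close>

definition uedges :: "('a, 'b) pre_digraph \<Rightarrow> 'a set set" where
  "uedges G = {{u, v} | u v. u \<rightarrow>\<^bsub>G\<^esub> v}"

text \<open>
  The constant is qualified because the unqualified name also denotes topological connectedness.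
  The bound on the order is the usual convention (so \<open>K\<^sub>2\<close> is not 2-connected).
\<close>

definition vertex_connected :: "nat \<Rightarrow> ('a, 'b) pre_digraph \<Rightarrow> bool" where
  "vertex_connected k G \<longleftrightarrow>
     k < card (verts G) \<and>
     (\<forall>X \<subseteq> verts G. card X < k \<longrightarrow> Digraph_Component.connected (G \<restriction> (verts G - X)))"

text \<open>
  A crossing-free drawing places the vertices at distinct points \<open>pos v\<close> of the plane and draws each
  edge \<open>e\<close> as an arc \<open>crv e\<close> joining its two ends, passing through no other vertex; two different
  arcs meet at most in common ends.
\<close>

definition plane_drawing ::
    "('a, 'b) pre_digraph \<Rightarrow> ('a \<Rightarrow> complex) \<Rightarrow> ('a set \<Rightarrow> real \<Rightarrow> complex) \<Rightarrow> bool" where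
  "plane_drawing G pos crv \<longleftrightarrow>
     inj_on pos (verts G) \<and>
     (\<forall>e \<in> uedges G.
        arc (crv e) \<and>
        {pathstart (crv e), pathfinish (crv e)} = pos ` e \<and>
        path_image (crv e) \<inter> pos ` verts G = pos ` e) \<and>
     (\<forall>e \<in> uedges G. \<forall>f \<in> uedges G. e \<noteq> f \<longrightarrow>
        path_image (crv e) \<inter> path_image (crv f) \<subseteq> pos ` (e \<inter> f))"

definition drawing_points ::
    "('a, 'b) pre_digraph \<Rightarrow> ('a \<Rightarrow> complex) \<Rightarrow> ('a set \<Rightarrow> real \<Rightarrow> complex) \<Rightarrow> complex set" where
  "drawing_points G pos crv = pos ` verts G \<union> (\<Union>e \<in> uedges G. path_image (crv e))"

text \<open>
  The drawing of a finite graph is compact, so its \<^const>\<open>outside\<close> is the unique unbounded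
  component of its complement, i.e. the outer face. Vertices are points of the drawing, hence
  being on the outer face means lying on its boundary.
\<close>

definition outerplanar :: "('a, 'b) pre_digraph \<Rightarrow> bool" where
  "outerplanar G \<longleftrightarrow>
     (\<exists>pos crv. plane_drawing G pos crv \<and>
        pos ` verts G \<subseteq> frontier (outside (drawing_points G pos crv)))"

definition induced_path :: "('a, 'b) pre_digraph \<Rightarrow> 'a list \<Rightarrow> bool" where
  "induced_path G p \<longleftrightarrow>
     vpath p G \<and>
     (\<forall>i < length p. \<forall>j < length p. p ! i \<rightarrow>\<^bsub>G\<^esub> p ! j \<longrightarrow> j = Suc i \<or> i = Suc j)"

end

theory Submission
  imports Defs
begin

text \<open>
  If three arcs with common ends \<open>a\<close>, \<open>b\<close> are otherwise disjoint, then one of them runs inside the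
  closed curve formed by the other two (Janiszewski's theorem). A vertex on the outer face lies
  inside no cycle, so an outerplanar graph contains no three internally disjoint paths between two
  vertices that all have inner vertices. By the usual ear argument a longest cycle of a 2-connected
  graph without such a configuration is Hamiltonian, and if there are at least five vertices then
  its chords do not cross.

  Number the vertices \<open>0, \<dots>, n - 1\<close> along the cycle. For \<open>i < j\<close> there are an induced path \<open>P\<close>
  from \<open>i\<close> inside \<open>[i, j)\<close> and an induced path \<open>Q\<close> from \<open>j\<close> inside \<open>(i, j]\<close> with
  \<open>4 (j - i) \<le> 2 ^ (|P| + |Q|)\<close>: let \<open>k < j\<close> be the largest neighbour of \<open>i\<close> and recurse into the
  larger of \<open>[i, k]\<close> and \<open>[k, j]\<close>. This at most halves the length, and either \<open>Q\<close> can be continued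
  from \<open>k\<close> up to \<open>j\<close> or \<open>P\<close> can be prolonged by \<open>i\<close>, so that one vertex is gained.
\<close>

section \<open>Induced paths in graphs with non-crossing chords\<close>

text \<open>Being an induced path, in a recursive form that suits paths growing at the head. Only
  edges from an earlier to a later entry are restricted, so \<open>E\<close> has to be symmetric for
  the list to be induced in the usual sense.\<close>

fun chordless :: "('a \<Rightarrow> 'a \<Rightarrow> bool) \<Rightarrow> 'a list \<Rightarrow> bool" where
  "chordless E [] \<longleftrightarrow> True"
| "chordless E (x # xs) \<longleftrightarrow> chordless E xs \<and> x \<notin> set xs \<and>
     (xs \<noteq> [] \<longrightarrow> E x (hd xs)) \<and> (\<forall>y \<in> set (tl xs). \<not> E x y)"

lemma chordless_distinct: "chordless E xs \<Longrightarrow> distinct xs"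
  by (induction xs) auto

lemma chordless_successively: "chordless E xs \<Longrightarrow> successively E xs"
proof (induction xs)
  case (Cons x xs)
  then show ?case by (cases xs) auto
qed simp

lemma chordless_nth_less:
  assumes "chordless E xs" "i < j" "j < length xs" "E (xs ! i) (xs ! j)"
  shows "j = Suc i"
  using assms
proof (induction xs arbitrary: i j)
  case (Cons x xs)
  show ?case
  proof (cases i)
    case 0
    show ?thesis
    proof (rule ccontr)
      assume "j \<noteq> Suc i"
      then obtain k where k: "j = Suc (Suc k)" using 0 Cons.prems(2)
        by (metis Suc_lessE less_zeroE not0_implies_Suc)
      then have "xs ! Suc k \<in> set (tl xs)"
        using Cons.prems(3) by (cases xs) auto
      then show False using Cons.prems k 0 by auto
    qed
  next
    case (Suc i')
    then obtain j' where "j = Suc j'" using Cons.prems(2) by (cases j) auto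
    then show ?thesis using Cons.IH[of i' j'] Cons.prems Suc by auto
  qed
qed simp

lemma chordless_map:
  assumes "chordless (\<lambda>i j. E (f i) (f j)) xs" "inj_on f (set xs)"
  shows "chordless E (map f xs)"
  using assms
  by (induction xs) (auto simp: hd_map inj_on_def map_tl[symmetric])

text \<open>Attach \<open>j\<close> to its smallest neighbour \<open>m\<close> in [k, j), and reach
  \<open>m\<close> by induction. Minimality of \<open>m\<close> excludes neighbours of
  \<open>j\<close> in [k, m). A neighbour strictly between \<open>i\<close> and \<open>k\<close>
  would give a chord crossing the one from \<open>i\<close> to \<open>k\<close>.\<close>

lemma chordless_extend_down:
  fixes E :: "nat \<Rightarrow> nat \<Rightarrow> bool"
  assumes sym: "symp E"
    and consec: "\<And>i. Suc i < n \<Longrightarrow> E i (Suc i)"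
    and noncross: "\<And>a b c d. a < b \<Longrightarrow> b < c \<Longrightarrow> c < d \<Longrightarrow> d < n \<Longrightarrow> E a c \<Longrightarrow> \<not> E b d"
    and ik: "E i k" "i < k"
    and Q: "chordless E Q" "Q \<noteq> []" "hd Q = k" "set Q \<subseteq> {i<..k}"
    and j: "k \<le> j" "j < n"
  shows "\<exists>R. chordless E R \<and> R \<noteq> [] \<and> hd R = j \<and> set R \<subseteq> {i<..j} \<and>
           length Q + (if k < j then 1 else 0) \<le> length R"
  using j
proof (induction j rule: less_induct)
  case (less j)
  show ?case
  proof (cases "k = j")
    case True
    then show ?thesis using Q by auto
  next
    case False
    with less.prems have kj: "k < j" by simp
    define m where "m = (LEAST m. k \<le> m \<and> E m j)"
    have ex: "k \<le> j - 1 \<and> E (j - 1) j"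
      using consec[of "j - 1"] kj less.prems by auto
    have m: "k \<le> m" "E m j" using LeastI[of "\<lambda>m. k \<le> m \<and> E m j", OF ex] by (auto simp: m_def)
    have mj: "m < j" using Least_le[of "\<lambda>m. k \<le> m \<and> E m j", OF ex] kj by (auto simp: m_def)
    have mmin: "\<not> E x j" if "k \<le> x" "x < m" for x
      using not_less_Least[of x "\<lambda>m. k \<le> m \<and> E m j"] that by (auto simp: m_def)
    obtain R where R: "chordless E R" "R \<noteq> []" "hd R = m" "set R \<subseteq> {i<..m}"
        "length Q + (if k < m then 1 else 0) \<le> length R"
      using less.IH[OF mj m(1)] mj less.prems by auto
    have "\<not> E j y" if y: "y \<in> set (tl R)" for y
    proof -
      have "y \<in> {i<..m}" using R(2,4) y by (meson list.set_sel(2) subsetD)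
      moreover have "y \<noteq> m"
        using chordless_distinct[OF R(1)] R(2,3) y by (cases R) auto
      ultimately have "i < y" "y < m" by auto
      have "\<not> E y j"
      proof (cases "y < k")
        case True
        then show ?thesis using noncross[of i y k j] ik \<open>i < y\<close> kj less.prems by auto
      next
        case False
        then show ?thesis using mmin \<open>y < m\<close> by auto
      qed
      then show ?thesis using sym by (auto dest: sympD)
    qed
    moreover have "j \<notin> set R" using R(4) mj by auto
    moreover have "E j m" using m(2) sym by (auto dest: sympD)
    ultimately have "chordless E (j # R)" using R by auto
    then show ?thesis
      using R mj ik(2) kj by (intro exI[of _ "j # R"]) auto
  qed
qed

text \<open>The half-open ranges carry the induction: \<open>i\<close> and \<open>j\<close> may be
  adjacent, so \<open>P\<close> must avoid \<open>j\<close> when \<open>i\<close> is put in front of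
  it, and \<open>Q\<close> must avoid \<open>i\<close> when it is continued to \<open>j\<close>.
  Bounding the sum of the lengths lets the gain fall on either path.\<close>

lemma two_chordless_paths:
  fixes E :: "nat \<Rightarrow> nat \<Rightarrow> bool"
  assumes sym: "symp E"
    and consec: "\<And>i. Suc i < n \<Longrightarrow> E i (Suc i)"
    and noncross: "\<And>a b c d. a < b \<Longrightarrow> b < c \<Longrightarrow> c < d \<Longrightarrow> d < n \<Longrightarrow> E a c \<Longrightarrow> \<not> E b d"
    and "i < j" "j < n"
  shows "\<exists>P Q. chordless E P \<and> P \<noteq> [] \<and> hd P = i \<and> set P \<subseteq> {i..<j} \<and>
           chordless E Q \<and> Q \<noteq> [] \<and> hd Q = j \<and> set Q \<subseteq> {i<..j} \<and>
           4 * (j - i) \<le> 2 ^ (length P + length Q)"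
  using \<open>i < j\<close> \<open>j < n\<close>
proof (induction "j - i" arbitrary: i j rule: less_induct)
  case less
  show ?case
  proof (cases "j = Suc i")
    case True
    \<comment> \<open>One vertex on each side gives equality in \<open>4 * 1 \<le> 2 ^ 2\<close>;
      this fixes the factor 4.\<close>
    then show ?thesis by (intro exI[of _ "[i]"] exI[of _ "[j]"]) auto
  next
    case False
    define A where "A = {k. i < k \<and> k < j \<and> E i k}"
    have "finite A" unfolding A_def by simp
    have "Suc i \<in> A" using consec[of i] less.prems False by (auto simp: A_def)
    define k where "k = Max A"
    have "k \<in> A" unfolding k_def using \<open>finite A\<close> \<open>Suc i \<in> A\<close> by (metis Max_in empty_iff)
    then have k: "i < k" "k < j" "E i k" by (auto simp: A_def)
    have kmax: "\<not> E i y" if "k < y" "y < j" for y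
    proof
      assume "E i y"
      then have "y \<in> A" using that k by (auto simp: A_def)
      then have "y \<le> k" unfolding k_def using \<open>finite A\<close> by (rule Max_ge[rotated])
      then show False using that by simp
    qed
    show ?thesis
    proof (cases "j - k \<le> k - i")
      case True
      obtain P Q where PQ: "chordless E P" "P \<noteq> []" "hd P = i" "set P \<subseteq> {i..<k}"
        "chordless E Q" "Q \<noteq> []" "hd Q = k" "set Q \<subseteq> {i<..k}"
        "4 * (k - i) \<le> 2 ^ (length P + length Q)"
        using less.hyps[of k i] k less.prems diff_less_mono[of k j i] by auto
      obtain R where R: "chordless E R" "R \<noteq> []" "hd R = j" "set R \<subseteq> {i<..j}"
           "length Q + 1 \<le> length R"
        using chordless_extend_down[of E n i k Q j] sym consec noncross k PQ less.prems by auto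
      have "4 * (j - i) \<le> 2 * (4 * (k - i))" using True k by simp
      also have "\<dots> \<le> 2 ^ (length P + length Q + 1)" using PQ(9) by simp
      also have "\<dots> \<le> 2 ^ (length P + length R)" using R(5) by (intro power_increasing) auto
      finally have "4 * (j - i) \<le> 2 ^ (length P + length R)" .
      then show ?thesis using PQ R k by (intro exI[of _ P] exI[of _ R]) auto
    next
      case False
      obtain P Q where PQ: "chordless E P" "P \<noteq> []" "hd P = k" "set P \<subseteq> {k..<j}"
        "chordless E Q" "Q \<noteq> []" "hd Q = j" "set Q \<subseteq> {k<..j}"
        "4 * (j - k) \<le> 2 ^ (length P + length Q)"
        using less.hyps[of j k] k less.prems diff_less_mono2[of i k j] by auto
      \<comment> \<open>All vertices of \<open>P\<close> other than its head \<open>k\<close> lie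
        strictly between \<open>k\<close> and \<open>j\<close>, where \<open>k\<close> being the
        largest neighbour of \<open>i\<close> applies.\<close>
      have "\<not> E i y" if y: "y \<in> set (tl P)" for y
      proof -
        have "y \<in> {k..<j}" using PQ(2,4) y by (meson list.set_sel(2) subsetD)
        moreover have "y \<noteq> k"
          using chordless_distinct[OF PQ(1)] PQ(2,3) y by (cases P) auto
        ultimately show ?thesis using kmax by auto
      qed
      moreover have "i \<notin> set P" using PQ(4) k by auto
      ultimately have "chordless E (i # P)" using PQ k by auto
      moreover have "4 * (j - i) \<le> 2 ^ (length (i # P) + length Q)"
        using False k PQ(9) by simp
      moreover have "set Q \<subseteq> {i<..j}" "set (i # P) \<subseteq> {i..<j}" using PQ k less.prems by auto
      ultimately show ?thesis using PQ by (intro exI[of _ "i # P"] exI[of _ Q]) auto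
    qed
  qed
qed

text \<open>Vertices are replaced by their positions in \<open>xs\<close>, and the interval argument
  is applied to the first and last position. The longer of the two paths has at least half of the
  total length, which turns base 2 into base 4.\<close>

lemma chordless_path_log:
  assumes sym: "symp E" and "xs \<noteq> []" "distinct xs" "successively E xs"
    and noncross: "\<And>a b c d. a < b \<Longrightarrow> b < c \<Longrightarrow> c < d \<Longrightarrow> d < length xs \<Longrightarrow>
      E (xs ! a) (xs ! c) \<Longrightarrow> \<not> E (xs ! b) (xs ! d)"
  shows "\<exists>p. chordless E p \<and> p \<noteq> [] \<and> set p \<subseteq> set xs \<and> length xs \<le> 4 ^ length p"
proof (cases "length xs = 1")
  case True
  then show ?thesis using \<open>xs \<noteq> []\<close> by (intro exI[of _ "[hd xs]"]) auto
next
  case False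
  define n where "n = length xs"
  define F where "F i j = E (xs ! i) (xs ! j)" for i j
  have n: "2 \<le> n" using False \<open>xs \<noteq> []\<close> by (cases xs) (auto simp: n_def Suc_le_eq)
  have *: "\<exists>p. chordless E p \<and> p \<noteq> [] \<and> set p \<subseteq> set xs \<and> length xs \<le> 4 ^ length p"
    if P: "chordless F P" "P \<noteq> []" "set P \<subseteq> {..<n}" "n \<le> 4 ^ length P" for P
  proof (intro exI[of _ "map ((!) xs) P"] conjI)
    have "inj_on ((!) xs) (set P)"
      using P(3) \<open>distinct xs\<close> by (auto simp: n_def inj_on_def nth_eq_iff_index_eq subset_iff)
    then show "chordless E (map ((!) xs) P)"
      using P(1) unfolding F_def by (intro chordless_map)
    show "set (map ((!) xs) P) \<subseteq> set xs" using P(3) by (auto simp: n_def subset_iff)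
  qed (use P in \<open>auto simp: n_def\<close>)
  have "symp F" using sym by (auto simp: F_def symp_def)
  moreover have "F i (Suc i)" if "Suc i < n" for i
    using \<open>successively E xs\<close> that by (auto simp: F_def n_def successively_conv_nth)
  moreover have "\<not> F b d" if "a < b" "b < c" "c < d" "d < n" "F a c" for a b c d
    using noncross that by (auto simp: F_def n_def)
  ultimately obtain P Q where PQ: "chordless F P" "P \<noteq> []" "set P \<subseteq> {0..<n - 1}"
       "chordless F Q" "Q \<noteq> []" "set Q \<subseteq> {0<..n - 1}"
       "4 * (n - 1) \<le> 2 ^ (length P + length Q)"
    using two_chordless_paths[of F n 0 "n - 1"] n by auto
  define m where "m = max (length P) (length Q)"
  \<comment> \<open>The factor 4 absorbs the difference between the number of vertices and the
    distance of the ends.\<close>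
  have "n \<le> 4 * (n - 1)" using n by simp
  also note PQ(7)
  also have "(2::nat) ^ (length P + length Q) \<le> 2 ^ (2 * m)"
    by (intro power_increasing) (auto simp: m_def)
  finally have "n \<le> 4 ^ m" by (simp add: power_mult)
  then show ?thesis
    using *[of P] *[of Q] PQ n by (fastforce simp: m_def max_def split: if_splits)
qed

section \<open>Hamiltonian cycles\<close>

text \<open>A subdivision of K_{2,3}, not necessarily induced. It has at least five vertices, so
  K_4, the other forbidden configuration of outerplanarity, contains none.\<close>

definition long_theta :: "('a \<Rightarrow> 'a \<Rightarrow> bool) \<Rightarrow> bool" where
  "long_theta E \<longleftrightarrow> (\<exists>a b p q r. p \<noteq> [] \<and> q \<noteq> [] \<and> r \<noteq> [] \<and> distinct (a # b # p @ q @ r) \<and>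
     successively E (a # p @ [b]) \<and> successively E (a # q @ [b]) \<and> successively E (a # r @ [b]))"

lemma long_thetaI:
  assumes "p \<noteq> []" "q \<noteq> []" "r \<noteq> []" "distinct (a # b # p @ q @ r)"
     "successively E (a # p @ [b])" "successively E (a # q @ [b])" "successively E (a # r @ [b])"
  shows "long_theta E"
  using assms unfolding long_theta_def by blast

text \<open>A single edge counts as a cycle of length 2, so that the ear argument has a starting point.\<close>

definition cyclic :: "('a \<Rightarrow> 'a \<Rightarrow> bool) \<Rightarrow> 'a list \<Rightarrow> bool" where
  "cyclic E xs \<longleftrightarrow> distinct xs \<and> 2 \<le> length xs \<and> successively E xs \<and> E (last xs) (hd xs)"

lemma cyclic_rotate: "cyclic E (xs @ ys) \<Longrightarrow> cyclic E (ys @ xs)"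
  by (cases "xs = []"; cases "ys = []") (auto simp: cyclic_def successively_append_iff)

lemma successively_infix: "successively E (us @ vs @ ws) \<Longrightarrow> successively E vs"
  by (auto simp: successively_append_iff)

lemma successively_rev_symp: "symp E \<Longrightarrow> successively E (rev xs) \<longleftrightarrow> successively E xs"
  by (simp add: successively_rev symp_conv_conversep_eq conversep_iff[abs_def])
     (metis (no_types, lifting) successively_mono sympD)

text \<open>Supplies ears. The walk is built from its far end: a new first vertex is put in front of
  the path, and if it already occurs there, the loop up to that occurrence is cut out.\<close>

lemma walk_to_first_hit:
  assumes "R\<^sup>*\<^sup>* v b" "v \<notin> C" "b \<in> C"
  shows "\<exists>p c. p \<noteq> [] \<and> hd p = v \<and> distinct p \<and> set p \<inter> C = {} \<and> c \<in> C \<and>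
           successively R (p @ [c])"
  using assms
proof (induction rule: converse_rtranclp_induct)
  case base
  then show ?case by simp
next
  case (step v w)
  show ?case
  proof (cases "w \<in> C")
    case True
    then show ?thesis using step by (intro exI[of _ "[v]"] exI[of _ w]) auto
  next
    case False
    then obtain p c where p: "p \<noteq> []" "hd p = w" "distinct p" "set p \<inter> C = {}" "c \<in> C"
           "successively R (p @ [c])"
      using step by blast
    show ?thesis
    proof (cases "v \<in> set p")
      case True
      then obtain p1 p2 where "p = p1 @ v # p2" by (meson split_list)
      then show ?thesis using p
        by (intro exI[of _ "v # p2"] exI[of _ c]) (auto simp: successively_append_iff)
    next
      case False
      have "successively R (v # p @ [c])"
        using p step.hyps(1) by (cases p) auto
      then show ?thesis using p False step.prems
        by (intro exI[of _ "v # p"] exI[of _ c]) auto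
    qed
  qed
qed

text \<open>The ends \<open>a\<close> and \<open>b\<close> cut the cycle into two arcs. If one of
  them is a single edge, the ear replaces it; otherwise both arcs and the ear have inner vertices
  and form a long theta.\<close>

lemma cyclic_add_ear:
  assumes sym: "symp E" and cyc: "cyclic E (a # ys)" and "b \<in> set ys"
    and ear: "p \<noteq> []" "distinct p" "set p \<inter> set (a # ys) = {}" "successively E (a # p @ [b])"
    and "\<not> long_theta E"
  shows "\<exists>zs. cyclic E zs \<and> set zs = set p \<union> set (a # ys)"
proof -
  obtain X Y where ys: "ys = X @ b # Y" using \<open>b \<in> set ys\<close> by (meson split_list)
  have rp: "successively E (b # rev p @ [a])"
    using ear(4) successively_rev_symp[OF sym, of "a # p @ [b]"] by simp
  consider "X = []" | "Y = []" | "X \<noteq> []" "Y \<noteq> []" by blast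
  then show ?thesis
  proof cases
    case 1
    then have "cyclic E (a # p @ b # Y)"
      using cyc ear ys by (cases "Y = []") (auto simp: cyclic_def successively_append_iff successively_Cons)
    then show ?thesis using 1 ys by (intro exI[of _ "a # p @ b # Y"]) auto
  next
    case 2
    have "successively E ((a # X @ [b]) @ rev p)"
      unfolding successively_append_iff[of _ "a # X @ [b]"]
      using cyc rp 2 ear(1) by (auto simp: cyclic_def ys successively_append_iff successively_Cons)
    moreover have "E (hd p) a"
      using ear(1,4) sym by (auto simp: successively_Cons dest: sympD)
    ultimately have "cyclic E (a # X @ b # rev p)"
      using cyc ear ys 2 by (auto simp: cyclic_def last_rev)
    then show ?thesis using 2 ys by (intro exI[of _ "a # X @ b # rev p"]) auto
  next
    case 3
    have "successively E (b # Y @ [a])"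
      using cyc ys 3 by (auto simp: cyclic_def successively_append_iff successively_Cons)
    then have "successively E (a # rev Y @ [b])"
      using successively_rev_symp[OF sym, of "b # Y @ [a]"] by simp
    moreover have "successively E (a # X @ [b])"
      using cyc ys 3 by (auto simp: cyclic_def successively_append_iff successively_Cons)
    moreover have "distinct (a # b # X @ rev Y @ p)"
      using cyc ys ear by (auto simp: cyclic_def)
    ultimately have "long_theta E"
      using 3 ear by (intro long_thetaI[of X "rev Y" p a b]) auto
    with \<open>\<not> long_theta E\<close> show ?thesis by blast
  qed
qed

text \<open>A longest cycle that misses a vertex would have an ear with inner vertices, and
  absorbing that ear yields a longer cycle.\<close>

lemma cyclic_spanning_exists:
  assumes "finite V" "2 \<le> card V" and sym: "symp E"
    and V: "\<And>u v. E u v \<Longrightarrow> u \<in> V \<and> v \<in> V" and irr: "\<And>u. \<not> E u u"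
    and conn: "\<And>X u v. X \<subseteq> V \<Longrightarrow> card X < 2 \<Longrightarrow> u \<in> V - X \<Longrightarrow> v \<in> V - X \<Longrightarrow>
      (\<lambda>x y. E x y \<and> x \<notin> X \<and> y \<notin> X)\<^sup>*\<^sup>* u v"
    and nt: "\<not> long_theta E"
  shows "\<exists>xs. cyclic E xs \<and> set xs = V"
proof -
  have cycV: "set xs \<subseteq> V" if "cyclic E xs" for xs
  proof
    fix x assume "x \<in> set xs"
    then obtain ys zs where "xs = ys @ x # zs" by (meson split_list)
    with that have "cyclic E (x # zs @ ys)" using cyclic_rotate[of E ys "x # zs"] by simp
    then show "x \<in> V" using V by (cases "zs @ ys") (auto simp: cyclic_def)
  qed
  define L where "L = {length xs | xs. cyclic E xs}"
  have "L \<subseteq> {..card V}"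
    using cycV \<open>finite V\<close>
    by (auto simp: L_def cyclic_def) (metis card_mono distinct_card)
  then have "finite L" using finite_subset by blast
  moreover have "L \<noteq> {}"
  proof -
    obtain u v where "u \<in> V" "v \<in> V" "u \<noteq> v"
      using \<open>2 \<le> card V\<close> by (auto simp: card_le_Suc_iff numeral_2_eq_2)
    then have "(\<lambda>x y. E x y \<and> x \<notin> {} \<and> y \<notin> {})\<^sup>*\<^sup>* u v" using conn[of "{}" u v] by simp
    then obtain w where "E u w" using \<open>u \<noteq> v\<close> by (auto elim: converse_rtranclpE)
    then have "cyclic E [u, w]" using irr sym by (auto simp: cyclic_def dest: sympD)
    then show ?thesis unfolding L_def by blast
  qed
  ultimately have "Max L \<in> L" by (rule Max_in)
  then obtain xs where xs: "cyclic E xs" "length xs = Max L" by (auto simp: L_def)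
  have max: "length ys \<le> length xs" if "cyclic E ys" for ys
    using that Max_ge[OF \<open>finite L\<close>, of "length ys"] xs by (auto simp: L_def)
  have "set xs = V"
  proof (rule ccontr)
    assume "set xs \<noteq> V"
    then obtain w where w: "w \<in> V" "w \<notin> set xs" using cycV[OF xs(1)] by auto
    have "xs \<noteq> []" using xs by (auto simp: cyclic_def)
    then have "hd xs \<in> V" using cycV[OF xs(1)] by auto
    \<comment> \<open>With nothing deleted, the missed vertex is joined to the cycle; the last step
      of that path is an edge from \<open>v\<close> off the cycle to \<open>a\<close> on it.\<close>
    then have "(\<lambda>x y. E x y \<and> x \<notin> {} \<and> y \<notin> {})\<^sup>*\<^sup>* w (hd xs)" using conn[of "{}" w "hd xs"] w by simp
    from walk_to_first_hit[OF this w(2)] \<open>xs \<noteq> []\<close>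
    obtain p a where pa: "p \<noteq> []" "set p \<inter> set xs = {}" "a \<in> set xs" "successively E (p @ [a])"
      by auto
    define v where "v = last p"
    have "v \<in> set p" using pa(1) by (simp add: v_def)
    moreover have "E v a" using pa by (auto simp: v_def successively_append_iff)
    ultimately have v: "E a v" "v \<notin> set xs" "v \<in> V" using pa(2) V sym by (auto dest: sympD)
    obtain ys zs where "xs = ys @ a # zs" using pa(3) by (meson split_list)
    define us where "us = zs @ ys"
    have cyc: "cyclic E (a # us)" and us: "set (a # us) = set xs"
      using xs(1) \<open>xs = ys @ a # zs\<close> cyclic_rotate[of E ys "a # zs"] by (auto simp: us_def)
    then have "us \<noteq> []" "a \<notin> set us" by (auto simp: cyclic_def)
    have hu: "hd us \<in> set us" using \<open>us \<noteq> []\<close> by simp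
    have "hd us \<in> V - {a}" using \<open>a \<notin> set us\<close> hu us cycV[OF xs(1)] by auto
    moreover have "v \<in> V - {a}" using v pa(3) by auto
    \<comment> \<open>Deleting \<open>a\<close> forces the path from \<open>v\<close> to come back
      to the cycle at some \<open>b\<close> different from \<open>a\<close>.\<close>
    ultimately have "(\<lambda>x y. E x y \<and> x \<notin> {a} \<and> y \<notin> {a})\<^sup>*\<^sup>* v (hd us)"
      using conn[of "{a}" v "hd us"] pa(3) cycV[OF xs(1)] by auto
    from walk_to_first_hit[OF this, of "set us"] v us hu
    obtain q b where q: "q \<noteq> []" "hd q = v" "distinct q" "set q \<inter> set us = {}" "b \<in> set us"
      and q': "successively (\<lambda>x y. E x y \<and> x \<notin> {a} \<and> y \<notin> {a}) (q @ [b])"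
      by auto
    have "successively E (q @ [b])" by (rule successively_mono[OF q']) auto
    then have "successively E (a # q @ [b])" using v q by (cases q) auto
    moreover have "a \<notin> set q"
    proof
      assume "a \<in> set q"
      then obtain q1 q2 where "q = q1 @ a # q2" by (meson split_list)
      with q' show False by (cases "q2") (auto simp: successively_append_iff)
    qed
    ultimately obtain zs where "cyclic E zs" "set zs = set q \<union> set (a # us)"
      using cyclic_add_ear[OF sym cyc q(5) q(1) q(3)] q(4) nt by auto
    moreover have "card (set q \<union> set (a # us)) > card (set xs)"
    proof (rule psubset_card_mono)
      show "set xs \<subset> set q \<union> set (a # us)"
        using us v(2) q(1,2) hd_in_set[OF q(1)] by auto
    qed auto
    ultimately show False
      using max[of zs] xs(1) by (auto simp: cyclic_def) (metis distinct_card leD xs(1) cyclic_def)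
  qed
  then show ?thesis using xs by blast
qed

section \<open>Chords of a Hamiltonian cycle\<close>

text \<open>Three ways from \<open>a\<close> to \<open>b\<close>: along \<open>X\<close>; over the
  chord to \<open>c\<close> and back through \<open>Y\<close>; backwards through \<open>W\<close> to
  \<open>d\<close> and over the chord. The last two have \<open>c\<close> and \<open>d\<close> as
  inner vertices, so a nonempty \<open>X\<close> completes the theta.\<close>

lemma crossing_chords_long_theta:
  assumes sym: "symp E" and cyc: "cyclic E (a # X @ b # Y @ c # Z @ d # W)"
    and "E a c" "E b d" "X \<noteq> []"
  shows "long_theta E"
proof (rule long_thetaI[of X "c # rev Y" "rev W @ [d]" a b])
  have s: "successively E (a # X @ b # Y @ c # Z @ d # W)" "E (last (d # W)) a"
    using cyc by (auto simp: cyclic_def)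
  have "successively E (b # Y @ [c])"
    by (rule successively_infix[of _ "a # X" _ "Z @ d # W"]) (use s in simp)
  moreover have "successively E (a # X @ [b])"
    by (rule successively_infix[of _ "[]" _ "Y @ c # Z @ d # W"]) (use s in simp)
  moreover have "successively E (d # W)"
    by (rule successively_infix[of _ "a # X @ b # Y @ c # Z" _ "[]"]) (use s in simp)
  then have "successively E ((d # W) @ [a])" using s(2) unfolding successively_append_iff by simp
  ultimately have "successively E (c # rev Y @ [b])" "successively E (a # rev W @ [d])"
    "successively E (a # X @ [b])"
    using successively_rev_symp[OF sym, of "b # Y @ [c]"] successively_rev_symp[OF sym, of "d # W @ [a]"]
    by auto
  moreover have "E d b" using \<open>E b d\<close> sym by (auto dest: sympD)
  ultimately show "successively E (a # X @ [b])" "successively E (a # (c # rev Y) @ [b])"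
    "successively E (a # (rev W @ [d]) @ [b])"
    using \<open>E a c\<close> successively_append_iff[of E "a # rev W @ [d]" "[b]"] by simp_all
qed (use cyc \<open>X \<noteq> []\<close> in \<open>auto simp: cyclic_def\<close>)

text \<open>Rotating the cycle lets each of the four gaps between the chord ends play the part of
  \<open>X\<close>. If all gaps are empty, the cycle has only four vertices.\<close>

lemma cyclic_chords_noncrossing:
  assumes sym: "symp E" and cyc: "cyclic E xs" and "5 \<le> length xs" and nt: "\<not> long_theta E"
    and ord: "i < j" "j < k" "k < l" "l < length xs" and "E (xs ! i) (xs ! k)"
  shows "\<not> E (xs ! j) (xs ! l)"
proof
  assume jl: "E (xs ! j) (xs ! l)"
  define a b c d where "a = xs ! i" and "b = xs ! j" and "c = xs ! k" and "d = xs ! l"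
  obtain T X Y Z W where xs: "xs = T @ a # X @ b # Y @ c # Z @ d # W"
  proof -
    have "xs = take i xs @ a # drop (Suc i) xs"
      using ord by (simp add: a_def id_take_nth_drop)
    moreover have "drop (Suc i) xs = take (j - Suc i) (drop (Suc i) xs) @ b # drop (Suc j) xs"
      using ord id_take_nth_drop[of "j - Suc i" "drop (Suc i) xs"] by (simp add: b_def)
    moreover have "drop (Suc j) xs = take (k - Suc j) (drop (Suc j) xs) @ c # drop (Suc k) xs"
      using ord id_take_nth_drop[of "k - Suc j" "drop (Suc j) xs"] by (simp add: c_def)
    moreover have "drop (Suc k) xs = take (l - Suc k) (drop (Suc k) xs) @ d # drop (Suc l) xs"
      using ord id_take_nth_drop[of "l - Suc k" "drop (Suc k) xs"] by (simp add: d_def)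
    ultimately show thesis using that by metis
  qed
  have e: "E a c" "E c a" "E b d" "E d b"
    using jl \<open>E (xs ! i) (xs ! k)\<close> sym by (auto simp: a_def b_def c_def d_def dest: sympD)
  \<comment> \<open>The gap from \<open>d\<close> to \<open>a\<close> wraps around the end of the
    list.\<close>
  define U where "U = W @ T"
  have 1: "cyclic E (a # X @ b # Y @ c # Z @ d # U)"
    using cyclic_rotate[of E T "a # X @ b # Y @ c # Z @ d # W"] cyc by (simp add: xs U_def)
  have 2: "cyclic E (b # Y @ c # Z @ d # U @ a # X)"
    using cyclic_rotate[of E "a # X" "b # Y @ c # Z @ d # U"] 1 by simp
  have 3: "cyclic E (c # Z @ d # U @ a # X @ b # Y)"
    using cyclic_rotate[of E "a # X @ b # Y" "c # Z @ d # U"] 1 by simp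
  have 4: "cyclic E (d # U @ a # X @ b # Y @ c # Z)"
    using cyclic_rotate[of E "a # X @ b # Y @ c # Z" "d # U"] 1 by simp
  have "X = []" "Y = []" "Z = []" "U = []"
    using crossing_chords_long_theta[OF sym 1] crossing_chords_long_theta[OF sym 2]
      crossing_chords_long_theta[OF sym 3] crossing_chords_long_theta[OF sym 4] e nt by auto
  then show False using \<open>5 \<le> length xs\<close> by (auto simp: xs U_def)
qed

section \<open>Theta curves in outerplanar drawings\<close>

lemma connected_subset_inside_or_outside:
  assumes "Topological_Spaces.connected T" "T \<inter> S = {}" "x \<in> T"
  shows "x \<in> inside S \<Longrightarrow> T \<subseteq> inside S" "x \<in> outside S \<Longrightarrow> T \<subseteq> outside S"
proof -
  have "connected_component (- S) x y" if "y \<in> T" for y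
    using assms that unfolding connected_component_def by blast
  then show "x \<in> inside S \<Longrightarrow> T \<subseteq> inside S" "x \<in> outside S \<Longrightarrow> T \<subseteq> outside S"
    using inside_same_component outside_same_component by blast+
qed

lemma Jordan_two_arcs:
  fixes g h :: "real \<Rightarrow> complex"
  assumes "arc g" "pathstart g = a" "pathfinish g = b"
    and "arc h" "pathstart h = a" "pathfinish h = b"
    and "path_image g \<inter> path_image h = {a, b}"
  defines "C \<equiv> path_image g \<union> path_image h"
  shows "inside C \<noteq> {}" "Topological_Spaces.connected (inside C)"
    "Topological_Spaces.connected (outside C)" "frontier (inside C) = C"
proof -
  let ?c = "g +++ reversepath h"
  have "simple_path ?c"
    using assms by (intro simple_path_join_loop) (auto simp: arc_reversepath)
  moreover have "pathfinish ?c = pathstart ?c" using assms by simp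
  moreover have "path_image ?c = C" using assms by (simp add: path_image_join)
  ultimately show "inside C \<noteq> {}" "Topological_Spaces.connected (inside C)"
    "Topological_Spaces.connected (outside C)" "frontier (inside C) = C"
    using Jordan_inside_outside[of ?c] by auto
qed

text \<open>The inside of \<open>c1\<close> and \<open>c2\<close> misses \<open>c1\<close> and
  \<open>c3\<close>, so, being connected, it would lie wholly inside that second curve once it meets
  its inside. Its boundary point \<open>x2\<close> would then be in the closure of that inside,
  although it lies in the open outside.\<close>

lemma theta_insides_disjoint:
  fixes c1 c2 c3 :: "real \<Rightarrow> complex"
  assumes "arc c1" "pathstart c1 = a" "pathfinish c1 = b"
    and "arc c2" "pathstart c2 = a" "pathfinish c2 = b"
    and "arc c3" "pathstart c3 = a" "pathfinish c3 = b"
    and i12: "path_image c1 \<inter> path_image c2 = {a, b}"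
    and i13: "path_image c1 \<inter> path_image c3 = {a, b}"
    and i23: "path_image c2 \<inter> path_image c3 = {a, b}"
    and out2: "path_image c2 - {a, b} \<subseteq> outside (path_image c1 \<union> path_image c3)"
    and out3: "path_image c3 - {a, b} \<subseteq> outside (path_image c1 \<union> path_image c2)"
    and x2: "x2 \<in> path_image c2 - {a, b}"
  shows "inside (path_image c1 \<union> path_image c2) \<inter> inside (path_image c1 \<union> path_image c3) = {}"
proof (rule ccontr)
  let ?D = "inside (path_image c1 \<union> path_image c2)"
  let ?S = "path_image c1 \<union> path_image c3"
  assume "?D \<inter> inside ?S \<noteq> {}"
  then obtain x where x: "x \<in> ?D" "x \<in> inside ?S" by blast
  have D: "Topological_Spaces.connected ?D" "frontier ?D = path_image c1 \<union> path_image c2"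
    using Jordan_two_arcs[of c1 a b c2] assms by auto
  have "?D \<inter> ?S = {}"
    using out3 i13 inside_Int_outside[of "path_image c1 \<union> path_image c2"]
      inside_no_overlap[of "path_image c1 \<union> path_image c2"] by blast
  then have "?D \<subseteq> inside ?S"
    using connected_subset_inside_or_outside(1)[OF D(1)] x by blast
  then have "closure ?D \<subseteq> closure (inside ?S)" by (rule closure_mono)
  moreover have "x2 \<in> closure ?D" using D(2) x2 frontier_def[of ?D] by auto
  moreover have "open (outside ?S)"
    using assms by (intro open_outside closed_Un) (auto simp: closed_arc_image)
  then have "outside ?S \<inter> closure (inside ?S) = {}"
    by (metis inside_Int_outside Int_commute open_Int_closure_eq_empty)
  ultimately show False using out2 x2 by blast
qed

text \<open>The points \<open>x1\<close>, \<open>x2\<close>, \<open>x3\<close> stand for whole arcs: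
  an arc without its ends is connected and misses the other two arcs, so one point decides on which
  side it runs.\<close>

lemma theta_arc_inside:
  fixes c1 c2 c3 :: "real \<Rightarrow> complex"
  assumes c1: "arc c1" "pathstart c1 = a" "pathfinish c1 = b"
    and c2: "arc c2" "pathstart c2 = a" "pathfinish c2 = b"
    and c3: "arc c3" "pathstart c3 = a" "pathfinish c3 = b"
    and i12: "path_image c1 \<inter> path_image c2 = {a, b}"
    and i13: "path_image c1 \<inter> path_image c3 = {a, b}"
    and i23: "path_image c2 \<inter> path_image c3 = {a, b}"
    and x1: "x1 \<in> path_image c1 - {a, b}"
    and x2: "x2 \<in> path_image c2 - {a, b}"
    and x3: "x3 \<in> path_image c3 - {a, b}"
  shows "x1 \<in> inside (path_image c2 \<union> path_image c3) \<or>
         x2 \<in> inside (path_image c1 \<union> path_image c3) \<or>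
         x3 \<in> inside (path_image c1 \<union> path_image c2)"
proof (rule ccontr)
  assume neg: "\<not> ?thesis"
  have out: "path_image c - {a, b} \<subseteq> outside S"
    if "arc c" "pathstart c = a" "pathfinish c = b" "x \<in> path_image c - {a, b}" "x \<notin> inside S"
      "path_image c \<inter> S \<subseteq> {a, b}" for c S x
  proof -
    have "Topological_Spaces.connected (path_image c - {a, b})"
      using connected_simple_path_endless[of c] that arc_imp_simple_path by auto
    moreover have "x \<in> outside S" using that inside_Un_outside[of S] by blast
    ultimately show ?thesis
      using connected_subset_inside_or_outside(2)[of "path_image c - {a, b}" S x] that by blast
  qed
  have o1: "path_image c1 - {a, b} \<subseteq> outside (path_image c2 \<union> path_image c3)"
    using out[OF c1 x1] neg i12 i13 by blast
  have o2: "path_image c2 - {a, b} \<subseteq> outside (path_image c1 \<union> path_image c3)"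
    using out[OF c2 x2] neg i12 i23 by blast
  have o3: "path_image c3 - {a, b} \<subseteq> outside (path_image c1 \<union> path_image c2)"
    using out[OF c3 x3] neg i13 i23 by blast
  let ?S = "path_image c1 \<union> path_image c2" and ?T = "path_image c1 \<union> path_image c3"
    and ?U = "path_image c2 \<union> path_image c3"
  have i12': "path_image c2 \<inter> path_image c1 = {a, b}" and i13': "path_image c3 \<inter> path_image c1 = {a, b}"
    and i23': "path_image c3 \<inter> path_image c2 = {a, b}" using i12 i13 i23 by blast+
  have U12: "?S = path_image c2 \<union> path_image c1" and U13: "?T = path_image c3 \<union> path_image c1"
    and U23: "?U = path_image c3 \<union> path_image c2" by blast+
  \<comment> \<open>A point inside one of the three closed curves lies outside the other two. These meet in a
    connected set, so Janiszewski's theorem joins the point to infinity off all three arcs.\<close>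
  obtain x where x: "x \<in> inside ?U"
    using Jordan_two_arcs(1)[OF c2 c3 i23] by blast
  have "x \<notin> inside ?S"
    using theta_insides_disjoint[OF c2 c1 c3 i12' i23 i13 o1 o3[unfolded U12] x1] x
    unfolding U12 by blast
  moreover have "x \<notin> inside ?T"
    using theta_insides_disjoint[OF c3 c1 c2 i13' i23' i12 o1[unfolded U23] o2[unfolded U13] x1] x
    unfolding U13 U23 by blast
  moreover have "x \<notin> ?U" using x inside_no_overlap[of ?U] by blast
  moreover have "x \<notin> path_image c1"
    using x o1 i12 i13 inside_Int_outside[of ?U] \<open>x \<notin> ?U\<close> by blast
  ultimately have xo: "x \<in> outside ?S" "x \<in> outside ?T"
    using inside_Un_outside[of ?S] inside_Un_outside[of ?T] by blast+
  have bdd: "bounded (?S \<union> ?T)"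
    using c1 c2 c3 by (simp add: bounded_arc_image)
  have "\<not> bounded (outside (?S \<union> ?T))" using bdd by (rule unbounded_outside)
  then obtain y where y: "y \<in> outside (?S \<union> ?T)" by (metis bounded_empty ex_in_conv)
  then have yo: "y \<in> outside ?S" "y \<in> outside ?T" "y \<in> outside ?U"
    using outside_mono[of ?S "?S \<union> ?T"] outside_mono[of ?T "?S \<union> ?T"]
      outside_mono[of ?U "?S \<union> ?T"] by blast+
  have ccS: "connected_component (- ?S) x y"
    unfolding connected_component_def
    using Jordan_two_arcs(3)[OF c1 c2 i12] xo yo outside_no_overlap[of ?S] by blast
  have ccT: "connected_component (- ?T) x y"
    unfolding connected_component_def
    using Jordan_two_arcs(3)[OF c1 c3 i13] xo yo outside_no_overlap[of ?T] by blast
  have "?S \<inter> ?T = path_image c1" using i12 i13 i23 by blast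
  then have conST: "Topological_Spaces.connected (?S \<inter> ?T)" using c1 by (simp add: connected_arc_image)
  have cpt: "compact ?S" "closed ?T"
    using c1 c2 c3 by (simp_all add: compact_Un compact_arc_image closed_Un closed_arc_image)
  have "connected_component (- (?S \<union> ?T)) x y"
    by (rule Janiszewski[OF cpt conST ccS ccT])
  \<comment> \<open>\<open>?U\<close> is contained in \<open>?S \<union> ?T\<close>, so the
    connection also avoids \<open>?U\<close> and would put the outer point \<open>y\<close> inside
    \<open>?U\<close>.\<close>
  then have "connected_component (- ?U) x y"
    by (rule connected_component_of_subset) auto
  then have "y \<in> inside ?U" using inside_same_component x by blast
  then show False using yo inside_Int_outside[of ?U] by blast
qed

section \<open>Walks as arcs of the drawing\<close>

text \<open>The union runs over the arcs of the walk, so a single vertex yields the empty set; hence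
  the bound \<open>2 \<le> length xs\<close> in the lemmas on walks.\<close>

definition edge_union :: "('a set \<Rightarrow> real \<Rightarrow> complex) \<Rightarrow> 'a list \<Rightarrow> complex set" where
  "edge_union crv xs = (\<Union>(u, v) \<in> set (vwalk_arcs xs). path_image (crv {u, v}))"

lemma edge_union_Cons: "xs \<noteq> [] \<Longrightarrow>
  edge_union crv (x # xs) = path_image (crv {x, hd xs}) \<union> edge_union crv xs"
  by (simp add: edge_union_def)

lemma vwalk_arcs_in_set: "(u, v) \<in> set (vwalk_arcs xs) \<Longrightarrow> u \<in> set xs \<and> v \<in> set xs"
  by (induction xs rule: vwalk_arcs.induct) auto

lemma successively_vwalk_arcs:
  "successively E xs \<longleftrightarrow> (\<forall>(u, v) \<in> set (vwalk_arcs xs). E u v)"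
  by (induction xs rule: vwalk_arcs.induct) auto

lemma plane_drawing_Int:
  assumes "plane_drawing G pos crv" "e \<in> uedges G" "f \<in> uedges G" "e \<noteq> f"
  shows "path_image (crv e) \<inter> path_image (crv f) \<subseteq> pos ` (e \<inter> f)"
  using assms by (simp add: plane_drawing_def)

lemma plane_drawing_Int_verts:
  assumes "plane_drawing G pos crv" "e \<in> uedges G"
  shows "path_image (crv e) \<inter> pos ` verts G = pos ` e"
  using assms by (simp add: plane_drawing_def)

lemma edge_union_Int:
  assumes "plane_drawing G pos crv" "successively (\<lambda>u v. u \<rightarrow>\<^bsub>G\<^esub> v) xs"
    "successively (\<lambda>u v. u \<rightarrow>\<^bsub>G\<^esub> v) ys"
    and ne: "\<And>u v u' v'. (u, v) \<in> set (vwalk_arcs xs) \<Longrightarrow> (u', v') \<in> set (vwalk_arcs ys) \<Longrightarrow> {u, v} \<noteq> {u', v'}"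
  shows "edge_union crv xs \<inter> edge_union crv ys \<subseteq> pos ` (set xs \<inter> set ys)"
proof
  fix z assume "z \<in> edge_union crv xs \<inter> edge_union crv ys"
  then obtain u v u' v' where uv: "(u, v) \<in> set (vwalk_arcs xs)" "z \<in> path_image (crv {u, v})"
    and uv': "(u', v') \<in> set (vwalk_arcs ys)" "z \<in> path_image (crv {u', v'})"
    by (auto simp: edge_union_def)
  have "{u, v} \<in> uedges G" "{u', v'} \<in> uedges G"
    using uv uv' assms(2,3) by (auto simp: uedges_def successively_vwalk_arcs)
  then have "z \<in> pos ` ({u, v} \<inter> {u', v'})"
    using plane_drawing_Int[OF assms(1) _ _ ne[OF uv(1) uv'(1)]] uv(2) uv'(2) by blast
  then show "z \<in> pos ` (set xs \<inter> set ys)"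
    using vwalk_arcs_in_set[OF uv(1)] vwalk_arcs_in_set[OF uv'(1)] by blast
qed

text \<open>Edge curves are joined one at a time. As the first vertex does not recur, the first
  curve meets the rest only at the second vertex, and the join is again an arc.\<close>

lemma walk_arc_exists:
  assumes draw: "plane_drawing G pos crv"
    and "successively (\<lambda>u v. u \<rightarrow>\<^bsub>G\<^esub> v) xs" "distinct xs" "2 \<le> length xs"
  shows "\<exists>g. arc g \<and> pathstart g = pos (hd xs) \<and> pathfinish g = pos (last xs) \<and>
           path_image g = edge_union crv xs"
  using assms(2-4)
proof (induction xs)
  case (Cons x ys)
  then obtain y zs where ys: "ys = y # zs" by (cases ys) auto
  have xy: "{x, y} \<in> uedges G" using Cons.prems by (auto simp: ys uedges_def)
  then have "arc (crv {x, y})" "{pathstart (crv {x, y}), pathfinish (crv {x, y})} = {pos x, pos y}"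
    using draw unfolding plane_drawing_def by (auto dest!: bspec[of _ _ "{x,y}"])
  \<comment> \<open>The drawing does not fix the direction of an edge curve, so it is reversed where
    necessary.\<close>
  then obtain h where h: "arc h" "pathstart h = pos x" "pathfinish h = pos y"
    "path_image h = path_image (crv {x, y})"
    by (metis doubleton_eq_iff arc_reversepath path_image_reversepath
        pathfinish_reversepath pathstart_reversepath)
  show ?case
  proof (cases "zs = []")
    case True
    then show ?thesis using h by (intro exI[of _ h]) (auto simp: ys edge_union_def)
  next
    case False
    then obtain g where g: "arc g" "pathstart g = pos y" "pathfinish g = pos (last ys)"
        "path_image g = edge_union crv ys"
      using Cons by (auto simp: ys Suc_le_eq)
    have "edge_union crv [x, y] \<inter> edge_union crv ys \<subseteq> pos ` (set [x, y] \<inter> set ys)"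
    proof (rule edge_union_Int[OF draw])
      fix u v u' v' assume "(u, v) \<in> set (vwalk_arcs [x, y])" "(u', v') \<in> set (vwalk_arcs ys)"
      then show "{u, v} \<noteq> {u', v'}"
        using Cons.prems(2) vwalk_arcs_in_set[of u' v' ys] by auto
    qed (use Cons.prems in \<open>auto simp: ys\<close>)
    also have "set [x, y] \<inter> set ys = {y}" using Cons.prems(2) by (auto simp: ys)
    finally have "path_image h \<inter> path_image g \<subseteq> {pos y}" by (simp add: edge_union_def h g)
    then have "arc (h +++ g)" using h g by (intro arc_join) auto
    then show ?thesis
      using h g by (intro exI[of _ "h +++ g"]) (auto simp: ys path_image_join edge_union_Cons)
  qed
qed simp

lemma edge_union_vertices:
  assumes draw: "plane_drawing G pos crv"
    and "successively (\<lambda>u v. u \<rightarrow>\<^bsub>G\<^esub> v) xs" "2 \<le> length xs" "x \<in> set xs"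
  shows "pos x \<in> edge_union crv xs"
proof -
  have *: "pos u \<in> path_image (crv {u, v}) \<and> pos v \<in> path_image (crv {u, v})" if "u \<rightarrow>\<^bsub>G\<^esub> v" for u v
  proof -
    have "{u, v} \<in> uedges G" using that by (auto simp: uedges_def)
    then have "path_image (crv {u, v}) \<inter> pos ` verts G = pos ` {u, v}"
      by (rule plane_drawing_Int_verts[OF draw])
    then show ?thesis by blast
  qed
  show ?thesis using assms(2-4)
  proof (induction xs)
    case (Cons y ys)
    then obtain z zs where "ys = z # zs" by (cases ys) auto
    then show ?case using Cons *[of y z] by (cases zs) (auto simp: edge_union_Cons edge_union_def)
  qed simp
qed

text \<open>Enlarging a set shrinks its outside. Hence the open set \<open>inside C\<close> misses
  \<open>outside D\<close>, therefore also its closure and its frontier.\<close>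

lemma outer_point_not_inside:
  fixes C D :: "'a::real_normed_vector set"
  assumes "v \<in> frontier (outside D)" "C \<subseteq> D" "closed C"
  shows "v \<notin> inside C"
proof
  assume v: "v \<in> inside C"
  have "inside C \<inter> outside D = {}"
    using outside_mono[OF assms(2)] inside_Int_outside[of C] by blast
  then have "inside C \<inter> closure (outside D) = {}"
    using open_inside[OF assms(3)] by (simp add: open_Int_closure_eq_empty)
  then show False using v assms(1) by (auto simp: frontier_def)
qed

text \<open>The three paths are drawn as three arcs, and an inner vertex is chosen on each. One of
  these vertices would be inside the curve formed by the other two arcs, which the outer face
  forbids.\<close>

lemma outerplanar_no_long_theta:
  assumes "wf_digraph G" "outerplanar G"
  shows "\<not> long_theta (\<lambda>u v. u \<rightarrow>\<^bsub>G\<^esub> v)"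
proof
  let ?E = "\<lambda>u v. u \<rightarrow>\<^bsub>G\<^esub> v"
  obtain pos crv where draw: "plane_drawing G pos crv"
    and outer: "pos ` verts G \<subseteq> frontier (outside (drawing_points G pos crv))"
    using assms(2) unfolding outerplanar_def by blast
  assume "long_theta ?E"
  then obtain a b p q r where ne: "p \<noteq> []" "q \<noteq> []" "r \<noteq> []"
    and dist: "distinct (a # b # p @ q @ r)"
    and walk: "successively ?E (a # p @ [b])" "successively ?E (a # q @ [b])" "successively ?E (a # r @ [b])"
    unfolding long_theta_def by blast
  define path where "path s \<longleftrightarrow> s \<noteq> [] \<and> successively ?E (a # s @ [b]) \<and> distinct (a # s @ [b])" for s
  define I where "I s = edge_union crv (a # s @ [b])" for s
  have paths: "path p" "path q" "path r"
    using ne dist walk by (auto simp: path_def)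
  have arcs: "\<exists>g. arc g \<and> pathstart g = pos a \<and> pathfinish g = pos b \<and> path_image g = I s"
    if "path s" for s
    using walk_arc_exists[OF draw, of "a # s @ [b]"] that by (auto simp: path_def I_def)
  have vertsI: "pos x \<in> I s" if "path s" "x \<in> set (a # s @ [b])" for s x
    unfolding I_def by (rule edge_union_vertices[OF draw]) (use that in \<open>auto simp: path_def\<close>)
  have subI: "I s \<subseteq> drawing_points G pos crv" if "path s" for s
  proof
    fix z assume "z \<in> I s"
    then obtain u v where uv: "(u, v) \<in> set (vwalk_arcs (a # s @ [b]))" "z \<in> path_image (crv {u, v})"
      unfolding I_def edge_union_def by blast
    moreover have "u \<rightarrow>\<^bsub>G\<^esub> v"
      using that uv(1) unfolding path_def successively_vwalk_arcs by blast
    ultimately show "z \<in> drawing_points G pos crv"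
      unfolding drawing_points_def uedges_def by blast
  qed
  have inV: "x \<in> verts G" if "path s" "x \<in> set (a # s @ [b])" for s x
  proof -
    from that(2) obtain us vs where uv: "a # s @ [b] = us @ x # vs" by (meson split_list)
    then have walk: "successively ?E (us @ x # vs)" using that(1) by (simp add: path_def)
    show ?thesis
    proof (cases vs)
      case Nil
      then have "us \<noteq> []" using uv that(1) by (cases us) auto
      then show ?thesis using walk wf_digraph.adj_in_verts(2)[OF assms(1)]
        by (auto simp: successively_append_iff)
    next
      case (Cons w ws)
      then show ?thesis using walk wf_digraph.adj_in_verts(1)[OF assms(1)]
        by (auto simp: successively_append_iff)
    qed
  qed
  have inter: "I s \<inter> I t = {pos a, pos b}" if st: "path s" "path t" "set s \<inter> set t = {}" for s t
  proof
    \<comment> \<open>Every edge of the walk has an inner vertex as an end because \<open>s\<close>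
      is nonempty. Walks with disjoint interiors therefore share no edge, and their drawings meet
      only in common vertices.\<close>
    have key: "u \<in> set s \<or> v \<in> set s" if "path s" "(u, v) \<in> set (vwalk_arcs (a # s @ [b]))" for s u v
    proof -
      have "s \<noteq> []" using that(1) by (simp add: path_def)
      then have "vwalk_arcs (a # s @ [b]) = (a, hd s) # vwalk_arcs s @ [(last s, b)]"
        by (simp add: vwalk_arcs_append)
      then show ?thesis using that(2) \<open>s \<noteq> []\<close> by (auto dest: vwalk_arcs_in_set)
    qed
    have "I s \<inter> I t \<subseteq> pos ` (set (a # s @ [b]) \<inter> set (a # t @ [b]))"
      unfolding I_def
    proof (rule edge_union_Int[OF draw])
      fix u v u' v'
      assume uv: "(u, v) \<in> set (vwalk_arcs (a # s @ [b]))" and uv': "(u', v') \<in> set (vwalk_arcs (a # t @ [b]))"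
      show "{u, v} \<noteq> {u', v'}"
      proof
        assume "{u, v} = {u', v'}"
        then obtain w where "w \<in> set s" "w \<in> {u', v'}" using key[OF st(1) uv] by auto
        then have "w \<in> set (a # t @ [b])" using vwalk_arcs_in_set[OF uv'] by auto
        then show False using \<open>w \<in> set s\<close> st by (auto simp: path_def)
      qed
    qed (use st in \<open>auto simp: path_def\<close>)
    also have "set (a # s @ [b]) \<inter> set (a # t @ [b]) = {a, b}" using st(3) by auto
    finally show "I s \<inter> I t \<subseteq> {pos a, pos b}" by simp
    show "{pos a, pos b} \<subseteq> I s \<inter> I t" using st vertsI by auto
  qed
  have mid: "pos (hd s) \<in> I s - {pos a, pos b}" if s: "path s" for s
  proof -
    have "inj_on pos (verts G)" using draw by (simp add: plane_drawing_def)
    moreover have hd: "hd s \<in> set s" using s by (simp add: path_def)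
    moreover have "hd s \<noteq> a" "hd s \<noteq> b" using s hd unfolding path_def by auto
    moreover have "hd s \<in> verts G" "a \<in> verts G" "b \<in> verts G" using inV[OF s] hd by simp_all
    moreover have "pos (hd s) \<in> I s" using vertsI[OF s] hd by simp
    ultimately show ?thesis by (simp add: inj_on_eq_iff)
  qed
  have not_inside: "pos (hd s) \<notin> inside (I t \<union> I u)" if s: "path s" "path t" "path u" for s t u
  proof (rule outer_point_not_inside)
    show "pos (hd s) \<in> frontier (outside (drawing_points G pos crv))"
      using outer inV[OF s(1), of "hd s"] s(1) by (auto simp: path_def)
    show "I t \<union> I u \<subseteq> drawing_points G pos crv" using subI s by blast
    show "closed (I t \<union> I u)" using arcs[OF s(2)] arcs[OF s(3)] closed_arc_image
      by (metis closed_Un)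
  qed
  obtain c1 where c1: "arc c1" "pathstart c1 = pos a" "pathfinish c1 = pos b" "path_image c1 = I p"
    using arcs paths(1) by blast
  obtain c2 where c2: "arc c2" "pathstart c2 = pos a" "pathfinish c2 = pos b" "path_image c2 = I q"
    using arcs paths(2) by blast
  obtain c3 where c3: "arc c3" "pathstart c3 = pos a" "pathfinish c3 = pos b" "path_image c3 = I r"
    using arcs paths(3) by blast
  have dis: "set p \<inter> set q = {}" "set p \<inter> set r = {}" "set q \<inter> set r = {}" using dist by auto
  show False
    using theta_arc_inside[OF c1(1-3) c2(1-3) c3(1-3), of "pos (hd p)" "pos (hd q)" "pos (hd r)"]
      not_inside paths mid[OF paths(1)] mid[OF paths(2)] mid[OF paths(3)]
      inter[OF paths(1,2) dis(1)] inter[OF paths(1,3) dis(2)] inter[OF paths(2,3) dis(3)]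
    by (simp add: c1 c2 c3)
qed

section \<open>The induced path\<close>

text \<open>Connectedness of a digraph refers to its symmetric closure. For symmetric
  \<open>G\<close> this closure adds no new adjacent pairs, so its walks are walks of
  \<open>G\<close> within \<open>S\<close>.\<close>

lemma reachable_induce_rtranclp:
  assumes "Digraph_Component.connected (G \<restriction> S)" "symmetric G" "u \<in> S" "v \<in> S"
  shows "(\<lambda>x y. x \<rightarrow>\<^bsub>G\<^esub> y \<and> x \<in> S \<and> y \<in> S)\<^sup>*\<^sup>* u v"
proof -
  have "u \<rightarrow>\<^sup>*\<^bsub>with_proj (mk_symmetric (G \<restriction> S))\<^esub> v"
    using assms by (auto simp: connected_def strongly_connected_def)
  then have "(u, v) \<in> (arcs_ends (with_proj (mk_symmetric (G \<restriction> S))))\<^sup>*"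
    unfolding reachable_def by (rule rtrancl_on_rtranclI)
  then show ?thesis
  proof (induction rule: rtrancl_induct)
    case (step y z)
    have "y \<rightarrow>\<^bsub>G\<^esub> z \<and> y \<in> S \<and> z \<in> S"
      using step(2) \<open>symmetric G\<close>
      by (auto simp: mk_symmetric_def arcs_ends_def arc_to_ends_def induce_subgraph_def symmetric_def
          dest: symD)
    then show ?case using step.IH by (simp add: rtranclp.rtrancl_into_rtrancl)
  qed simp
qed

theorem theorem8:
  fixes G :: "('a, 'b) pre_digraph" and n :: nat
  assumes "graph G"
    and "vertex_connected 2 G"
    and "outerplanar G"
    and "card (verts G) = n"
  shows "\<exists>p. induced_path G p \<and> real (length p) \<ge> log 2 (real n) / 2"
proof -
  interpret graph G by fact
  let ?E = "\<lambda>u v. u \<rightarrow>\<^bsub>G\<^esub> v"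
  have sym: "symp ?E" using sym_arcs by (auto simp: symp_def symmetric_def dest: symD)
  have n: "3 \<le> n" using assms(2,4) by (simp add: vertex_connected_def)
  have "\<exists>p. chordless ?E p \<and> p \<noteq> [] \<and> set p \<subseteq> verts G \<and> n \<le> 4 ^ length p"
  \<comment> \<open>With four vertices the chords may cross abstractly without a long theta, but for
    \<open>n \<le> 4\<close> a single vertex already satisfies the bound.\<close>
  proof (cases "5 \<le> n")
    case True
    have nt: "\<not> long_theta ?E" using outerplanar_no_long_theta assms(3) wf_digraph by blast
    have "\<exists>xs. cyclic ?E xs \<and> set xs = verts G"
    proof (rule cyclic_spanning_exists[OF _ _ sym _ _ _ nt])
      fix X u v assume X: "X \<subseteq> verts G" "card X < 2" "u \<in> verts G - X" "v \<in> verts G - X"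
      then have "Digraph_Component.connected (G \<restriction> (verts G - X))"
        using assms(2) by (simp add: vertex_connected_def)
      from reachable_induce_rtranclp[OF this sym_arcs X(3,4)]
      show "(\<lambda>x y. x \<rightarrow>\<^bsub>G\<^esub> y \<and> x \<notin> X \<and> y \<notin> X)\<^sup>*\<^sup>* u v"
        by (rule rtranclp_mono[THEN predicate2D, rotated]) auto
    qed (use n assms(4) adj_not_same in \<open>auto intro: adj_in_verts\<close>)
    then obtain xs where xs: "cyclic ?E xs" "set xs = verts G" by blast
    then have len: "length xs = n" using assms(4) distinct_card[of xs] by (simp add: cyclic_def)
    have "\<exists>p. chordless ?E p \<and> p \<noteq> [] \<and> set p \<subseteq> set xs \<and> length xs \<le> 4 ^ length p"
    proof (rule chordless_path_log[OF sym])
      show "xs \<noteq> []" using len True by auto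
      show "distinct xs" "successively ?E xs" using xs(1) by (simp_all add: cyclic_def)
    qed (use cyclic_chords_noncrossing[OF sym xs(1) _ nt] len True in blast)
    then show ?thesis using xs(2) len by simp
  next
    case False
    obtain v where "v \<in> verts G" using n assms(4) by (metis card.empty ex_in_conv not_numeral_le_zero)
    then show ?thesis using False by (intro exI[of _ "[v]"]) auto
  qed
  then obtain p where p: "chordless ?E p" "p \<noteq> []" "set p \<subseteq> verts G" "n \<le> 4 ^ length p" by blast
  have "vpath p G"
    using p chordless_distinct[OF p(1)] chordless_successively[OF p(1)]
    by (auto simp: vpath_def vwalk_def successively_vwalk_arcs)
  moreover have "j = Suc i \<or> i = Suc j"
    if "i < length p" "j < length p" "p ! i \<rightarrow>\<^bsub>G\<^esub> p ! j" for i j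
  proof -
    have "i \<noteq> j" using adj_not_same that(3) by auto
    then consider "i < j" | "j < i" by linarith
    then show ?thesis
      \<comment> \<open>\<open>chordless\<close> only speaks about edges towards later entries;
        symmetry covers the case \<open>j < i\<close>.\<close>
      using chordless_nth_less[OF p(1)] that(1,2) that(3) sympD[OF sym that(3)]
      by cases blast+
  qed
  ultimately have "induced_path G p" unfolding induced_path_def by blast
  moreover have "log 2 (real n) / 2 \<le> real (length p)"
  proof -
    have "real n \<le> 4 ^ length p" using p(4) by (metis of_nat_le_iff of_nat_numeral of_nat_power)
    \<comment> \<open>Base 4 is what becomes the factor one half in front of the binary
      logarithm.\<close>
    also have "\<dots> = 2 ^ (2 * length p)" by (simp add: power_mult)
    also have "\<dots> = 2 powr real (2 * length p)" by (simp only: powr_realpow zero_less_numeral)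
    finally have "log 2 (real n) \<le> real (2 * length p)"
      using n by (subst log_le_iff) auto
    then show ?thesis by simp
  qed
  ultimately show ?thesis by blast
qed

end
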